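(* Let $n\ge 1$ and let $\mu$ be the tube-measure on $\mathbb{R}^n$. A set $E\subseteq\mathbb{R}^n$ is tube-measurable if and only if $\mu(E)=0$ or $\mu(\mathbb{R}^n\setminus E)=0$. That is, the only tube-measurable subsets of $\mathbb{R}^n$ are the tube-null sets and their complements.
   Context: A tube of cross-sectional radius $r>0$ in $\mathbb{R}^n$ is the closed $r$-neighbourhood $\{x\in\mathbb{R}^n:\operatorname{dist}(x,\ell)\le r\}$ of some (infinite) straight line $\ell\subseteq\mathbb{R}^n$. For $E\subseteq\mathbb{R}^n$ the tube-measure is the outer measure $$\mu(E):=\inf\left\{\sum_i \gamma_{n-1}r_i^{n-1} : \bigcup_i T_i\supseteq E\right\},$$ where the infimum is over all countable (finite, possibly empty, or countably infinite) families of tubes $T_i$, with $T_i$ of cross-sectional radius $r_i>0$, covering $E$, and $\gamma_{n-1}$ is the volume (Lebesgue measure) of the unit ball of $\mathbb{R}^{n-1}$ (with $\gamma_0=1$). A set $E$ is tube-null if $\mu(E)=0$. A set $E$ is tube-measurable (or $\mu$-measurable) if it is measurable in the sense of Carathéodory with respect to $\mu$: $\mu(A)=\mu(A\cap E)+\mu(A\setminus E)$ for every $A\subseteq\mathbb{R}^n$. *)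

theory Defs
  imports "HOL-Analysis.Analysis"
begin

definition straight_line :: "'a::euclidean_space set \<Rightarrow> bool" where
  "straight_line L \<longleftrightarrow> affine L \<and> aff_dim L = 1"

definition tube :: "'a::euclidean_space set \<Rightarrow> real \<Rightarrow> 'a set" where
  "tube L r = {x. infdist x L \<le> r}"

(* A family of tubes is given by its axes L i and radii r i, for i in an index set I of natural
   numbers, so that finite (in particular empty) families are included. The radius is part of the
   data because in dimension 1 every tube is the whole line and does not determine it. *)
definition tube_cover ::
    "'a::euclidean_space set \<Rightarrow> nat set \<Rightarrow> (nat \<Rightarrow> 'a set) \<Rightarrow> (nat \<Rightarrow> real) \<Rightarrow> bool" where
  "tube_cover E I L r \<longleftrightarrow>
     (\<forall>i\<in>I. straight_line (L i) \<and> r i > 0) \<and> E \<subseteq> (\<Union>i\<in>I. tube (L i) (r i))"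

(* unit_ball_vol (real k) is the volume of the unit ball in dimension k, and is 1 for k = 0.
   The infinite sum is taken in ennreal, where it always exists. *)
definition tube_measure :: "'a::euclidean_space set \<Rightarrow> ennreal" where
  "tube_measure E =
     Inf {(\<Sum>\<^sub>\<infinity>i\<in>I. ennreal (unit_ball_vol (real (DIM('a) - 1)) * r i ^ (DIM('a) - 1))) | I L r.
            tube_cover E I L r}"

definition tube_measurable :: "'a::euclidean_space set \<Rightarrow> bool" where
  "tube_measurable E \<longleftrightarrow> E \<in> lambda_system UNIV UNIV tube_measure"

lemma tube_measurable_iff:
  "tube_measurable E \<longleftrightarrow>
     (\<forall>A. tube_measure A = tube_measure (A \<inter> E) + tube_measure (A - E))"
proof -
  have *: "(UNIV - E) \<inter> A = A - E" for A
    by blast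
  have "tube_measurable E \<longleftrightarrow>
          (\<forall>A. tube_measure (E \<inter> A) + tube_measure ((UNIV - E) \<inter> A) = tube_measure A)"
    unfolding tube_measurable_def lambda_system_def by blast
  also have "\<dots> \<longleftrightarrow> (\<forall>A. tube_measure A = tube_measure (A \<inter> E) + tube_measure (A - E))"
    unfolding * Int_commute[of E] by (rule iffI; rule allI; drule spec; erule sym)
  finally show ?thesis .
qed

end

theory Submission
  imports Defs
begin

text \<open>
  Null sets and their complements are measurable for every outer measure; the content is the
  converse. It rests on the fact that a ball of radius \<open>r\<close> has the same tube-measure as an
  infinite tube of radius \<open>r\<close> containing it (\<open>tube_measure_cball\<close>, \<open>tube_measure_tube\<close>).

  For this fact, give the ball of radius \<open>R\<close> the density \<open>1 / sqrt (R\<^sup>2 - |x|\<^sup>2)\<close>. Its integral along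
  every line meeting the open ball is \<open>\<pi>\<close>, so a tube of radius \<open>r\<close> carries at most the mass
  \<open>m * r ^ (n - 1)\<close>, while the ball carries exactly \<open>m * R ^ (n - 1)\<close> with the same constant \<open>m\<close>
  (\<open>ball_density_mass_tube_le\<close>, \<open>nn_integral_ball_density\<close>). Hence no cover of the ball by tubes is
  cheaper than the one tube circumscribed about it.

  Let \<open>E\<close> be measurable. It splits ball and tube additively, and these have the same finite measure,
  so \<open>E\<close> has the same trace on both. Any two points are joined by a line; therefore
  \<open>\<mu> (T \<inter> E) = g r\<close> for all tubes \<open>T\<close> of radius \<open>r\<close>, with a function \<open>g\<close> of the radius
  alone (\<open>tube_trace_eq\<close>). Let \<open>c r\<close> be the quotient of \<open>g r\<close> by the cost of a tube of radius \<open>r\<close>.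
  If \<open>c\<close> is bounded by some \<open>q < 1\<close>, then replacing the tubes of a cover of \<open>A \<subseteq> E\<close> by
  their traces on \<open>E\<close> gains the factor \<open>q\<close>, which forces \<open>\<mu> E = 0\<close> (\<open>tube_null_if_sparse\<close>).
  The same applies to the complement of \<open>E\<close>, whose quotient is \<open>1 - c r\<close>. So if neither set is
  null, \<open>c\<close> takes values arbitrarily close to \<open>1\<close> and to \<open>0\<close>. But covering a large ball economically by
  small tubes shows that \<open>c R \<le> K * c r\<close> and \<open>1 - c R \<le> K * (1 - c r)\<close> for \<open>r \<le> R\<close>, where \<open>K\<close>
  depends only on \<open>n\<close> (\<open>tube_trace_growth\<close>). For a large radius, then, both \<open>c\<close> and \<open>1 - c\<close> would be
  small, which is absurd.
\<close>

section \<open>The tube-measure as an outer measure\<close>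

definition tube_cost :: "'a::euclidean_space itself \<Rightarrow> real \<Rightarrow> ennreal" where
  "tube_cost _ r = ennreal (unit_ball_vol (real (DIM('a) - 1)) * r ^ (DIM('a) - 1))"

lemma infsum_ennreal_eq_suminf:
  fixes f :: "nat \<Rightarrow> ennreal"
  shows "infsum f I = (\<Sum>i. if i \<in> I then f i else 0)"
proof -
  let ?g = "\<lambda>i. if i \<in> I then f i else 0"
  have "infsum f I = infsum ?g UNIV"
    by (rule infsum_cong_neutral) auto
  moreover have "?g sums infsum ?g UNIV"
    by (intro has_sum_imp_sums has_sum_infsum nonneg_summable_on_complete) simp
  ultimately show ?thesis
    by (simp add: sums_iff)
qed

text \<open>Padding with zeros over all of \<^typ>\<open>nat\<close> gives access to the theory of ordinary series,
  in particular to the rearrangement of double series and to monotone convergence.\<close>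

lemma tube_measure_alt:
  "tube_measure (A :: 'a::euclidean_space set) =
     Inf {(\<Sum>i. if i \<in> I then tube_cost TYPE('a) (r i) else 0) | I L r. tube_cover A I L r}"
  unfolding tube_measure_def tube_cost_def infsum_ennreal_eq_suminf ..

lemma tube_measure_le_cover:
  fixes A :: "'a::euclidean_space set"
  assumes "tube_cover A I L r"
  shows "tube_measure A \<le> (\<Sum>i. if i \<in> I then tube_cost TYPE('a) (r i) else 0)"
  unfolding tube_measure_alt by (rule Inf_lower) (use assms in blast)

lemma tube_measure_greatest:
  fixes A :: "'a::euclidean_space set"
  assumes "\<And>I L r. tube_cover A I L r \<Longrightarrow>
             x \<le> (\<Sum>i. if i \<in> I then tube_cost TYPE('a) (r i) else 0)"
  shows "x \<le> tube_measure A"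
  unfolding tube_measure_alt
proof (rule Inf_greatest, elim CollectE exE conjE, hypsubst)
qed (rule assms)

lemma tube_measure_empty [simp]: "tube_measure {} = 0"
proof -
  have "tube_cover {} {} L r" for L :: "nat \<Rightarrow> 'a set" and r
    by (simp add: tube_cover_def)
  from tube_measure_le_cover[OF this] show ?thesis
    by simp
qed

lemma tube_measure_mono:
  assumes "A \<subseteq> B"
  shows "tube_measure A \<le> tube_measure B"
  by (intro tube_measure_greatest tube_measure_le_cover) (use assms in \<open>auto simp: tube_cover_def\<close>)

text \<open>Near-optimal covers of the pieces, with errors summing to \<open>e\<close>, are merged into one cover
  by means of the pairing function.\<close>

lemma tube_measure_countably_subadditive:
  fixes A :: "nat \<Rightarrow> 'a::euclidean_space set"
  shows "tube_measure (\<Union>k. A k) \<le> (\<Sum>k. tube_measure (A k))"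
proof (rule ennreal_le_epsilon)
  fix e :: real
  assume fin: "(\<Sum>k. tube_measure (A k)) < top" and e: "0 < e"
  define d where "d k = e * (1/2) ^ Suc k" for k :: nat
  have d: "0 < d k" for k
    using e by (simp add: d_def)
  have "\<exists>I L r. tube_cover (A k) I L r \<and>
          (\<Sum>i. if i \<in> I then tube_cost TYPE('a) (r i) else 0) < tube_measure (A k) + ennreal (d k)"
    for k
  proof -
    have "tube_measure (A k) < top"
      using fin by (metis ennreal_suminf_lessD)
    then have "tube_measure (A k) < tube_measure (A k) + ennreal (d k)"
      using d[of k] by (simp add: ennreal_less_zero_iff less_top)
    then show ?thesis
      unfolding tube_measure_alt[of "A k"] Inf_less_iff by blast
  qed
  then obtain I L r where cover: "\<And>k. tube_cover (A k) (I k) (L k) (r k)"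
    and less: "\<And>k. (\<Sum>i. if i \<in> I k then tube_cost TYPE('a) (r k i) else 0)
                       < tube_measure (A k) + ennreal (d k)"
    by metis
  define J where "J = {j. case prod_decode j of (k, i) \<Rightarrow> i \<in> I k}"
  define LL where "LL = (\<lambda>j. case prod_decode j of (k, i) \<Rightarrow> L k i)"
  define rr where "rr = (\<lambda>j. case prod_decode j of (k, i) \<Rightarrow> r k i)"
  have "tube_cover (\<Union>k. A k) J LL rr"
    unfolding tube_cover_def
  proof (intro conjI ballI subsetI)
    fix j assume "j \<in> J"
    then show "straight_line (LL j)" "0 < rr j"
      using cover unfolding J_def LL_def rr_def tube_cover_def by (auto split: prod.splits)
  next
    fix x assume "x \<in> (\<Union>k. A k)"
    then obtain k where "x \<in> A k"
      by blast
    with cover[of k] obtain i where "i \<in> I k" "x \<in> tube (L k i) (r k i)"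
      unfolding tube_cover_def by blast
    then show "x \<in> (\<Union>j\<in>J. tube (LL j) (rr j))"
      by (intro UN_I[of "prod_encode (k, i)"]) (auto simp: J_def LL_def rr_def)
  qed
  then have "tube_measure (\<Union>k. A k) \<le> (\<Sum>j. if j \<in> J then tube_cost TYPE('a) (rr j) else 0)"
    by (rule tube_measure_le_cover)
  also have "\<dots> = (\<Sum>j. (\<lambda>(k, i). if i \<in> I k then tube_cost TYPE('a) (r k i) else 0) (prod_decode j))"
    by (intro suminf_cong) (auto simp: J_def rr_def split: prod.splits)
  also have "\<dots> = (\<Sum>k. \<Sum>i. if i \<in> I k then tube_cost TYPE('a) (r k i) else 0)"
    by (rule suminf_ennreal_2dimen) simp
  also have "\<dots> \<le> (\<Sum>k. tube_measure (A k) + ennreal (d k))"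
    by (intro suminf_le less_imp_le less) auto
  also have "\<dots> = (\<Sum>k. tube_measure (A k)) + (\<Sum>k. ennreal (d k))"
    by (intro suminf_add[symmetric]) auto
  also have "(\<Sum>k. ennreal (d k)) = ennreal e"
    using sums_mult[OF power_half_series, of e] less_imp_le[OF d]
    by (intro suminf_ennreal_eq) (auto simp: d_def)
  finally show "tube_measure (\<Union>k. A k) \<le> (\<Sum>k. tube_measure (A k)) + ennreal e" .
qed

lemma tube_measure_subadditive:
  "tube_measure (A \<union> B) \<le> tube_measure A + tube_measure B"
proof -
  define C where "C k = (if k = 0 then A else if k = 1 then B else {})" for k :: nat
  have "(\<Union>k. C k) = A \<union> B"
    by (auto simp: C_def split: if_splits)
  moreover have "(\<Sum>k. tube_measure (C k)) = (\<Sum>k<2. tube_measure (C k))"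
    by (rule suminf_finite) (auto simp: C_def)
  moreover have "\<dots> = tube_measure A + tube_measure B"
    by (simp add: C_def numeral_2_eq_2)
  ultimately show ?thesis
    using tube_measure_countably_subadditive[of C] by simp
qed

lemma tube_measure_finitely_subadditive:
  assumes "finite S"
  shows "tube_measure (\<Union>s\<in>S. A s) \<le> (\<Sum>s\<in>S. tube_measure (A s))"
  using assms
proof induction
  case (insert s S)
  then show ?case
    using tube_measure_subadditive[of "A s" "\<Union>s\<in>S. A s"]
    by (auto intro: order_trans add_left_mono)
qed simp

lemma tube_measurable_if_null:
  assumes "tube_measure E = 0 \<or> tube_measure (UNIV - E) = 0"
  shows "tube_measurable E"
  unfolding tube_measurable_iff
proof
  fix A
  have "tube_measure (A \<inter> E) \<le> tube_measure E" "tube_measure (A - E) \<le> tube_measure (UNIV - E)"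
    "tube_measure (A - E) \<le> tube_measure A" "tube_measure (A \<inter> E) \<le> tube_measure A"
    by (intro tube_measure_mono; blast)+
  then have "tube_measure (A \<inter> E) + tube_measure (A - E) \<le> tube_measure A"
    using assms by auto
  moreover have "(A \<inter> E) \<union> (A - E) = A"
    by blast
  ultimately show "tube_measure A = tube_measure (A \<inter> E) + tube_measure (A - E)"
    using tube_measure_subadditive[of "A \<inter> E" "A - E"] by (intro antisym) auto
qed

lemma tube_measurable_Compl:
  "tube_measurable (UNIV - E) \<longleftrightarrow> tube_measurable E"
proof -
  have "A \<inter> (UNIV - E) = A - E" "A - (UNIV - E) = A \<inter> E" for A
    by auto
  then show ?thesis
    unfolding tube_measurable_iff by (simp add: add.commute)
qed

section \<open>Straight lines and tubes\<close>

lemma straight_line_range: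
  fixes a u :: "'a::euclidean_space"
  assumes "u \<noteq> 0"
  shows "straight_line (range (\<lambda>t. a + t *\<^sub>R u))"
proof -
  have "range (\<lambda>t. a + t *\<^sub>R u) = affine hull {a, a + u}"
    by (auto simp: affine_hull_2_alt)
  then show ?thesis
    using assms by (simp add: straight_line_def affine_affine_hull)
qed

lemma straight_line_unit_speed:
  fixes L :: "'a::euclidean_space set"
  assumes "straight_line L"
  obtains a u where "norm u = 1" "L = range (\<lambda>t. a + t *\<^sub>R u)"
proof -
  have L: "affine L" "aff_dim L = 1"
    using assms by (auto simp: straight_line_def)
  then have "L \<noteq> {}"
    by auto
  then obtain a where a: "a \<in> L"
    by blast
  moreover have "L \<noteq> {a}"
    using L by auto
  ultimately obtain b where b: "b \<in> L" "b \<noteq> a"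
    by blast
  have "affine hull {a, b} = L"
  proof (rule affine_dim_equal)
    show "affine hull {a, b} \<subseteq> L"
      using a b L by (intro hull_minimal) auto
  qed (use L b in \<open>auto simp: affine_affine_hull\<close>)
  then have "L = range (\<lambda>t. a + t *\<^sub>R (b - a))"
    by (simp add: affine_hull_2_alt)
  also have "\<dots> = range (\<lambda>t. a + t *\<^sub>R sgn (b - a))"
  proof (intro equalityI subsetI; elim rangeE; hypsubst)
    show "a + t *\<^sub>R (b - a) \<in> range (\<lambda>t. a + t *\<^sub>R sgn (b - a))" for t
      using b by (intro range_eqI[of _ _ "t * norm (b - a)"]) (simp add: sgn_div_norm)
    show "a + t *\<^sub>R sgn (b - a) \<in> range (\<lambda>t. a + t *\<^sub>R (b - a))" for t
      by (intro range_eqI[of _ _ "t / norm (b - a)"]) (simp add: sgn_div_norm divide_inverse)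
  qed
  finally show ?thesis
    using b by (intro that[of "sgn (b - a)" a]) (auto simp: norm_sgn)
qed

text \<open>For a unit vector \<open>u\<close> this is the projection of \<open>x\<close> to the hyperplane orthogonal to \<open>u\<close>.
  With it, the distance to a line of direction \<open>u\<close> is a norm.\<close>

definition perp :: "'a::euclidean_space \<Rightarrow> 'a \<Rightarrow> 'a" where
  "perp u x = x - (x \<bullet> u) *\<^sub>R u"

lemma perp_add_scaleR [simp]:
  assumes "norm u = 1"
  shows "perp u (x + t *\<^sub>R u) = perp u x"
proof -
  have "(x + t *\<^sub>R u) \<bullet> u = x \<bullet> u + t"
    using assms by (simp add: inner_add_left norm_eq_1)
  then show ?thesis
    unfolding perp_def by (simp only: scaleR_add_left) simp
qed

lemma norm_line_pythagoras:
  assumes "norm u = 1"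
  shows "(norm (x + t *\<^sub>R u))\<^sup>2 = (norm (perp u x))\<^sup>2 + (x \<bullet> u + t)\<^sup>2"
proof -
  have "perp u x \<bullet> u = 0"
    using assms by (simp add: perp_def inner_diff_left norm_eq_1)
  then have "orthogonal (perp u x) ((x \<bullet> u + t) *\<^sub>R u)"
    by (simp add: orthogonal_def)
  moreover have "x + t *\<^sub>R u = perp u x + (x \<bullet> u + t) *\<^sub>R u"
    by (simp add: perp_def scaleR_add_left)
  ultimately have "(norm (x + t *\<^sub>R u))\<^sup>2 =
      (norm (perp u x))\<^sup>2 + (norm ((x \<bullet> u + t) *\<^sub>R u))\<^sup>2"
    by (simp only: norm_add_Pythagorean)
  then show ?thesis
    using assms by simp
qed

lemma norm_perp_le:
  assumes "norm u = 1"
  shows "norm (perp u x) \<le> norm x"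
proof (rule power2_le_imp_le)
  show "(norm (perp u x))\<^sup>2 \<le> (norm x)\<^sup>2"
    using norm_line_pythagoras[OF assms, of x 0] zero_le_power2[of "x \<bullet> u + 0"]
    by (simp del: zero_le_power2)
qed simp

lemma tube_perp_le:
  assumes "norm u = 1" "y \<in> tube (range (\<lambda>t. a + t *\<^sub>R u)) r"
  shows "norm (perp u (y - a)) \<le> r"
proof -
  let ?L = "range (\<lambda>t. a + t *\<^sub>R u)"
  have "u \<noteq> 0"
    using assms(1) by auto
  then have "closed ?L"
    using straight_line_range[of u a] by (simp add: straight_line_def affine_closed)
  then obtain z where "z \<in> ?L" "infdist y ?L = dist y z"
    using infdist_attains_inf[of ?L y] by auto
  then obtain t where "infdist y ?L = norm ((y - a) + (- t) *\<^sub>R u)"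
    by (auto simp: dist_norm algebra_simps)
  moreover have "norm (perp u (y - a)) \<le> norm ((y - a) + (- t) *\<^sub>R u)"
    using norm_perp_le[OF assms(1), of "(y - a) + (- t) *\<^sub>R u"]
    by (simp only: perp_add_scaleR[OF assms(1)])
  ultimately show ?thesis
    using assms(2) by (simp add: tube_def)
qed

lemma cball_subset_tube:
  assumes "x \<in> L"
  shows "cball x r \<subseteq> tube L r"
proof
  fix y assume "y \<in> cball x r"
  then show "y \<in> tube L r"
    using infdist_le[OF assms, of y] by (simp add: tube_def dist_commute)
qed

lemma tube_measure_tube_le:
  fixes L :: "'a::euclidean_space set"
  assumes "straight_line L" "r > 0"
  shows "tube_measure (tube L r) \<le> tube_cost TYPE('a) r"
proof -
  have "tube_measure (tube L r) \<le> (\<Sum>i::nat. if i \<in> {0} then tube_cost TYPE('a) r else 0)"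
    by (rule tube_measure_le_cover[where L = "\<lambda>_. L"]) (use assms in \<open>auto simp: tube_cover_def\<close>)
  also have "\<dots> = (\<Sum>i\<in>{0::nat}. if i \<in> {0} then tube_cost TYPE('a) r else 0)"
    by (rule suminf_finite) auto
  finally show ?thesis
    by simp
qed

section \<open>A density with constant line integrals\<close>

text \<open>In dimension \<open>n\<close> this is, up to a factor, the density of the image of the surface measure of the
  sphere of dimension \<open>n\<close> under the projection along one axis. Projecting along a second axis
  gives the uniform measure on a ball of dimension \<open>n - 1\<close> (Archimedes' hat-box theorem for
  \<open>n = 2\<close>), which is why the integrals along chords come out constant.\<close>

definition ball_density :: "real \<Rightarrow> 'a::euclidean_space \<Rightarrow> ennreal" where
  "ball_density R x = (if norm x < R then ennreal (1 / sqrt (R\<^sup>2 - (norm x)\<^sup>2)) else 0)"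

lemma ball_density_measurable [measurable]: "ball_density R \<in> borel_measurable borel"
  unfolding ball_density_def by measurable

lemma perp_measurable [measurable]: "perp u \<in> borel_measurable borel"
  unfolding perp_def by measurable

text \<open>The antiderivative \<open>arcsin (t / s)\<close> is continuous up to the end points, where the integrand
  is singular and its value is the default \<open>1 / 0 = 0\<close>.\<close>

lemma nn_integral_arcsine_density:
  assumes "s > 0"
  shows "(\<integral>\<^sup>+t. ennreal (1 / sqrt (s\<^sup>2 - t\<^sup>2)) * indicator {-s..s} t \<partial>lborel) = ennreal pi"
proof -
  have deriv: "((\<lambda>t. arcsin (t / s)) has_vector_derivative 1 / sqrt (s\<^sup>2 - t\<^sup>2)) (at t)"
    if "t \<in> {-s<..<s}" for t
  proof -
    have "-1 < t / s" "t / s < 1"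
      using that assms by (auto simp: field_simps)
    then have "((\<lambda>t. arcsin (t / s)) has_real_derivative
                 inverse (sqrt (1 - (t / s)\<^sup>2)) * (1 / s)) (at t)"
      by (intro DERIV_chain2[OF DERIV_arcsin]) (use assms in \<open>auto intro!: derivative_eq_intros\<close>)
    also have "inverse (sqrt (1 - (t / s)\<^sup>2)) * (1 / s) = 1 / sqrt (s\<^sup>2 * (1 - (t / s)\<^sup>2))"
      using assms by (simp add: real_sqrt_mult divide_inverse)
    also have "s\<^sup>2 * (1 - (t / s)\<^sup>2) = s\<^sup>2 - t\<^sup>2"
      using assms by (simp add: right_diff_distrib power_divide)
    finally show ?thesis
      by (simp add: has_real_derivative_iff_has_vector_derivative)
  qed
  have "((\<lambda>t. 1 / sqrt (s\<^sup>2 - t\<^sup>2)) has_integral (arcsin (s / s) - arcsin (- s / s))) {-s..s}"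
  proof (rule fundamental_theorem_of_calculus_interior)
    show "continuous_on {-s..s} (\<lambda>t. arcsin (t / s))"
      using assms by (intro continuous_intros) (use assms in \<open>auto simp: field_simps\<close>)
  qed (use assms deriv in auto)
  moreover have "arcsin (s / s) - arcsin (- s / s) = pi"
    using assms by simp
  ultimately have I: "((\<lambda>t. 1 / sqrt (s\<^sup>2 - t\<^sup>2)) has_integral pi) {-s..s}"
    by simp
  show ?thesis
  proof (rule nn_integral_has_integral_lebesgue'[OF _ I])
    fix t assume "t \<in> {-s..s}"
    then have "t\<^sup>2 \<le> s\<^sup>2"
      by (simp add: abs_le_square_iff[symmetric] abs_le_iff)
    then show "0 \<le> 1 / sqrt (s\<^sup>2 - t\<^sup>2)"
      by simp
  qed
qed

text \<open>On a line at distance \<open>d < R\<close> from the centre the density restricts to the arcsine density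
  of the chord of half-length \<open>sqrt (R\<^sup>2 - d\<^sup>2)\<close>, whose mass does not depend on that length.\<close>

lemma nn_integral_ball_density_line:
  assumes u: "norm u = 1" and R: "R > 0"
  shows "(\<integral>\<^sup>+t. ball_density R (x + t *\<^sub>R u) \<partial>lborel) =
           (if norm (perp u x) < R then ennreal pi else 0)"
proof -
  define d where "d = norm (perp u x)"
  define s where "s = sqrt (R\<^sup>2 - d\<^sup>2)"
  define h where "h t = (if d\<^sup>2 + t\<^sup>2 < R\<^sup>2 then ennreal (1 / sqrt (R\<^sup>2 - d\<^sup>2 - t\<^sup>2)) else 0)"
    for t :: real
  have [measurable]: "h \<in> borel_measurable borel"
    unfolding h_def by measurable
  have "norm y < R \<longleftrightarrow> (norm y)\<^sup>2 < R\<^sup>2" for y :: 'a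
    using R by (metis norm_ge_zero power2_less_imp_less power_strict_mono less_imp_le pos2)
  then have "ball_density R (x + t *\<^sub>R u) = h (x \<bullet> u + 1 * t)" for t
    unfolding ball_density_def by (simp add: norm_line_pythagoras[OF u] h_def d_def diff_diff_eq)
  then have "(\<integral>\<^sup>+t. ball_density R (x + t *\<^sub>R u) \<partial>lborel) = (\<integral>\<^sup>+t. h t \<partial>lborel)"
    using nn_integral_real_affine[of h 1 "x \<bullet> u"] by simp
  also have "\<dots> = (if d < R then ennreal pi else 0)"
  proof (cases "d < R")
    case True
    then have "d\<^sup>2 < R\<^sup>2"
      by (intro power_strict_mono) (auto simp: d_def)
    then have s: "s > 0" "s\<^sup>2 = R\<^sup>2 - d\<^sup>2"
      by (auto simp: s_def)
    have "h t = ennreal (1 / sqrt (s\<^sup>2 - t\<^sup>2)) * indicator {-s..s} t" for t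
    proof -
      have "d\<^sup>2 + t\<^sup>2 < R\<^sup>2 \<longleftrightarrow> \<bar>t\<bar> < s"
        using s abs_le_square_iff[of s t] by auto
      moreover have "1 / sqrt (s\<^sup>2 - t\<^sup>2) = 0" if "\<bar>t\<bar> = s"
        using that by auto
      ultimately show ?thesis
        using s(2) by (auto simp: h_def indicator_def abs_if split: if_splits)
    qed
    then show ?thesis
      using nn_integral_arcsine_density[OF s(1)] True by simp
  next
    case False
    then have "R\<^sup>2 \<le> d\<^sup>2"
      using R by (intro power_mono) auto
    then have "h t = 0" for t
      unfolding h_def by (smt (verit) zero_le_power2)
    then show ?thesis
      using False by simp
  qed
  finally show ?thesis
    by (simp add: d_def)
qed

text \<open>Integration over translates along \<open>u\<close> may be moved from one factor of a product to the other.
  This takes the place of splitting the space into the direction \<open>u\<close> and the hyperplane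
  orthogonal to it: only translation invariance of Lebesgue measure enters.\<close>

lemma nn_integral_line_swap:
  fixes f w :: "'a::euclidean_space \<Rightarrow> ennreal"
  assumes [measurable]: "f \<in> borel_measurable borel" "w \<in> borel_measurable borel"
  shows "(\<integral>\<^sup>+y. f y * (\<integral>\<^sup>+t. w (y + t *\<^sub>R u) \<partial>lborel) \<partial>lborel) =
         (\<integral>\<^sup>+x. w x * (\<integral>\<^sup>+t. f (x - t *\<^sub>R u) \<partial>lborel) \<partial>lborel)"
proof -
  have "(\<integral>\<^sup>+y. f y * (\<integral>\<^sup>+t. w (y + t *\<^sub>R u) \<partial>lborel) \<partial>lborel) =
        (\<integral>\<^sup>+y. (\<integral>\<^sup>+t. f y * w (y + t *\<^sub>R u) \<partial>lborel) \<partial>lborel)"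
    by (simp add: nn_integral_cmult)
  also have "\<dots> = (\<integral>\<^sup>+t. (\<integral>\<^sup>+y. f y * w (y + t *\<^sub>R u) \<partial>lborel) \<partial>lborel)"
    by (rule lborel_pair.Fubini') simp
  also have "\<dots> = (\<integral>\<^sup>+t. (\<integral>\<^sup>+x. f (x - t *\<^sub>R u) * w x \<partial>lborel) \<partial>lborel)"
  proof (rule nn_integral_cong)
    fix t :: real
    have "(\<integral>\<^sup>+x. f (x - t *\<^sub>R u) * w x \<partial>lborel) =
          (\<integral>\<^sup>+x. f (x - t *\<^sub>R u) * w x \<partial>distr lborel borel ((+) (t *\<^sub>R u)))"
      by (simp only: lborel_distr_plus)
    also have "\<dots> = (\<integral>\<^sup>+y. f y * w (y + t *\<^sub>R u) \<partial>lborel)"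
      by (subst nn_integral_distr) (auto simp: add.commute)
    finally show "(\<integral>\<^sup>+y. f y * w (y + t *\<^sub>R u) \<partial>lborel) = (\<integral>\<^sup>+x. f (x - t *\<^sub>R u) * w x \<partial>lborel)"
      by simp
  qed
  also have "\<dots> = (\<integral>\<^sup>+x. (\<integral>\<^sup>+t. f (x - t *\<^sub>R u) * w x \<partial>lborel) \<partial>lborel)"
    by (rule lborel_pair.Fubini') simp
  also have "\<dots> = (\<integral>\<^sup>+x. w x * (\<integral>\<^sup>+t. f (x - t *\<^sub>R u) \<partial>lborel) \<partial>lborel)"
    by (simp add: mult.commute[of _ "w _"] nn_integral_cmult)
  finally show ?thesis .
qed

definition ball_mass :: "'a::euclidean_space itself \<Rightarrow> ennreal" where
  "ball_mass _ = (\<integral>\<^sup>+x. ball_density 1 (x :: 'a) \<partial>lborel)"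

text \<open>Scaling by \<open>r\<close> multiplies volume by \<open>r ^ n\<close> and the density by \<open>1 / r\<close>. The mass of a ball
  is therefore proportional to the cost of a tube of the same radius.\<close>

lemma nn_integral_ball_density:
  fixes a :: "'a::euclidean_space"
  assumes r: "r > 0"
  shows "(\<integral>\<^sup>+x. ball_density r (x - a) \<partial>lborel) = ball_mass TYPE('a) * ennreal (r ^ (DIM('a) - 1))"
proof -
  have scale: "ball_density r (r *\<^sub>R x) = ennreal (1 / r) * ball_density 1 x" for x :: 'a
  proof -
    have "r\<^sup>2 - (r * norm x)\<^sup>2 = r\<^sup>2 * (1 - (norm x)\<^sup>2)"
      by (simp add: algebra_simps power_mult_distrib)
    moreover have "r * norm x < r \<longleftrightarrow> norm x < 1"
      using r by simp
    ultimately show ?thesis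
      using r by (auto simp: ball_density_def real_sqrt_mult ennreal_mult'[symmetric])
  qed
  have "(\<integral>\<^sup>+x. ball_density r (x - a) \<partial>lborel) =
        (\<integral>\<^sup>+x. ball_density r (x - a) \<partial>density (distr lborel borel (\<lambda>x. a + r *\<^sub>R x)) (\<lambda>_. ennreal (\<bar>r\<bar> ^ DIM('a))))"
    using r lborel_affine[of r a] by simp
  also have "\<dots> = (\<integral>\<^sup>+x. ennreal (r ^ DIM('a)) * (ennreal (1 / r) * ball_density 1 (x :: 'a)) \<partial>lborel)"
    using r by (simp add: nn_integral_density nn_integral_distr scale)
  also have "\<dots> = (\<integral>\<^sup>+x. ennreal (r ^ (DIM('a) - 1)) * ball_density 1 (x :: 'a) \<partial>lborel)"
  proof -
    have "r ^ DIM('a) * (1 / r) = r ^ (DIM('a) - 1)"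
      using r by (simp add: power_diff)
    then show ?thesis
      using r by (simp add: mult.assoc[symmetric] ennreal_mult'[symmetric] del: times_divide_eq_right)
  qed
  also have "\<dots> = ball_mass TYPE('a) * ennreal (r ^ (DIM('a) - 1))"
    by (simp add: nn_integral_cmult ball_mass_def mult.commute[of "integral\<^sup>N _ _"])
  finally show ?thesis .
qed

text \<open>The decisive estimate: an open tube of radius \<open>r\<close> carries at most the mass of a ball of radius
  \<open>r\<close>, whatever the radius \<open>R\<close> of the ball on which the density lives. By the line integral formula,
  \<open>pi\<close> times the indicator of the tube is the integral over all translates, along the axis, of the
  density \<open>w\<close> of a ball of radius \<open>r\<close> centred on the axis. Moved to the density of radius \<open>R\<close>, this
  integration contributes at most \<open>pi\<close>, and the mass of \<open>w\<close> remains.\<close>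

lemma ball_density_mass_tube_le:
  fixes a c u :: "'a::euclidean_space"
  assumes u: "norm u = 1" and R: "R > 0" and r: "r > 0"
  shows "(\<integral>\<^sup>+y. ball_density R (y - c) * indicator {y. norm (perp u (y - a)) < r} y \<partial>lborel)
           \<le> ball_mass TYPE('a) * ennreal (r ^ (DIM('a) - 1))"
proof -
  define w where "w x = ball_density r (x - a)" for x :: 'a
  have [measurable]: "w \<in> borel_measurable borel"
    unfolding w_def by measurable
  have w: "(\<integral>\<^sup>+t. w (y + t *\<^sub>R u) \<partial>lborel) = ennreal pi * indicator {y. norm (perp u (y - a)) < r} y" for y
    using nn_integral_ball_density_line[OF u r, of "y - a"] by (simp add: w_def algebra_simps)
  have f: "(\<integral>\<^sup>+t. ball_density R (x - t *\<^sub>R u - c) \<partial>lborel) \<le> ennreal pi" for x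
    using nn_integral_ball_density_line[of "- u" R "x - c"] u R by (simp add: algebra_simps)
  have "ennreal pi * (\<integral>\<^sup>+y. ball_density R (y - c) * indicator {y. norm (perp u (y - a)) < r} y \<partial>lborel)
      = (\<integral>\<^sup>+y. ball_density R (y - c) * (\<integral>\<^sup>+t. w (y + t *\<^sub>R u) \<partial>lborel) \<partial>lborel)"
    unfolding w by (subst nn_integral_cmult[symmetric]) (auto simp: ac_simps)
  also have "\<dots> = (\<integral>\<^sup>+x. w x * (\<integral>\<^sup>+t. ball_density R (x - t *\<^sub>R u - c) \<partial>lborel) \<partial>lborel)"
    by (rule nn_integral_line_swap) simp_all
  also have "\<dots> \<le> (\<integral>\<^sup>+x. ennreal pi * w x \<partial>lborel)"
    by (intro nn_integral_mono) (use f in \<open>simp add: mult.commute[of "ennreal pi"] mult_left_mono\<close>)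
  also have "\<dots> = ennreal pi * (ball_mass TYPE('a) * ennreal (r ^ (DIM('a) - 1)))"
    using nn_integral_ball_density[OF r, of a] by (simp add: nn_integral_cmult w_def)
  finally show ?thesis
    using pi_gt_zero by (simp add: ennreal_mult_le_mult_iff)
qed

text \<open>The same exchange with \<open>w\<close> the indicator of a larger ball: the integrals of \<open>w\<close> along the
  lines through points of the unit ball are at least \<open>1\<close>, while those of the density are at most \<open>pi\<close>.\<close>

lemma ball_mass_finite: "ball_mass TYPE('a::euclidean_space) < top"
proof -
  obtain u :: 'a where u: "norm u = 1"
    using nonempty_Basis norm_Basis by blast
  define w :: "'a \<Rightarrow> ennreal" where "w = indicator (cball 0 2)"
  have [measurable]: "w \<in> borel_measurable borel"
    unfolding w_def by (intro borel_measurable_indicator) simp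
  have "ball_density 1 y \<le> ball_density 1 y * (\<integral>\<^sup>+t. w (y + t *\<^sub>R u) \<partial>lborel)" for y
  proof (cases "norm y < 1")
    case True
    have "indicator {0..1} t \<le> w (y + t *\<^sub>R u)" for t
    proof (cases "t \<in> {0..1}")
      case t: True
      have "norm (y + t *\<^sub>R u) \<le> norm y + \<bar>t\<bar>"
        using norm_triangle_ineq[of y "t *\<^sub>R u"] u by simp
      with t True show ?thesis
        by (auto simp: w_def)
    qed auto
    then have "(\<integral>\<^sup>+t. indicator {0..1::real} t \<partial>lborel) \<le> (\<integral>\<^sup>+t. w (y + t *\<^sub>R u) \<partial>lborel)"
      by (intro nn_integral_mono) auto
    then have "1 \<le> (\<integral>\<^sup>+t. w (y + t *\<^sub>R u) \<partial>lborel)"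
      by simp
    then show ?thesis
      using mult_left_mono[of 1 _ "ball_density 1 y"] by fastforce
  qed (simp add: ball_density_def)
  then have "ball_mass TYPE('a) \<le> (\<integral>\<^sup>+y. ball_density 1 y * (\<integral>\<^sup>+t. w (y + t *\<^sub>R u) \<partial>lborel) \<partial>lborel)"
    unfolding ball_mass_def by (intro nn_integral_mono) auto
  also have "\<dots> = (\<integral>\<^sup>+x. w x * (\<integral>\<^sup>+t. ball_density 1 (x - t *\<^sub>R u) \<partial>lborel) \<partial>lborel)"
    by (rule nn_integral_line_swap) simp_all
  also have "\<dots> \<le> (\<integral>\<^sup>+x. ennreal pi * w x \<partial>lborel)"
    using nn_integral_ball_density_line[of "- u" 1] u
    by (intro nn_integral_mono) (simp add: mult.commute[of "ennreal pi"] mult_left_mono)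
  also have "\<dots> = ennreal pi * emeasure lborel (cball (0::'a) 2)"
    unfolding w_def by (rule nn_integral_cmult_indicator) simp
  also have "\<dots> < top"
    using emeasure_lborel_cball_finite[of "0::'a" 2] by (simp add: ennreal_mult_less_top)
  finally show ?thesis .
qed

lemma ball_mass_pos: "0 < ball_mass TYPE('a::euclidean_space)"
proof -
  have "emeasure lborel (ball (0::'a) 1) = (\<integral>\<^sup>+x. indicator (ball (0::'a) 1) x \<partial>lborel)"
    by simp
  also have "\<dots> \<le> ball_mass TYPE('a)"
    unfolding ball_mass_def
  proof (intro nn_integral_mono)
    fix x :: 'a
    have "1 \<le> 1 / sqrt (1 - (norm x)\<^sup>2)" if "norm x < 1"
    proof -
      have "(norm x)\<^sup>2 < 1"
        using that by (simp add: power_less_one_iff abs_square_less_1)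
      then have "0 < sqrt (1 - (norm x)\<^sup>2)" "sqrt (1 - (norm x)\<^sup>2) \<le> 1"
        by auto
      then show ?thesis
        by simp
    qed
    then show "indicator (ball 0 1) x \<le> ball_density 1 x"
      by (auto simp: ball_density_def indicator_def ennreal_1[symmetric] simp del: ennreal_1 intro: ennreal_leI)
  qed
  finally show ?thesis
    using content_ball_pos[of 1 "0::'a"] 
    by (metis emeasure_lborel_ball_finite emeasure_eq_ennreal_measure ennreal_less_zero_iff order_less_le_trans zero_less_one less_irrefl infinity_ennreal_def)
qed

section \<open>The tube-measure of balls and tubes\<close>

lemma borel_tube [measurable]: "tube L r \<in> sets borel"
  unfolding tube_def by (intro borel_closed closed_Collect_le continuous_on_infdist continuous_intros)

text \<open>A closed tube lies in open tubes of radius arbitrarily close to its own.\<close>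

lemma ball_density_mass_closed_tube_le:
  fixes c :: "'a::euclidean_space"
  assumes L: "straight_line L" and R: "R > 0" and r: "r > 0"
  shows "(\<integral>\<^sup>+y. ball_density R (y - c) * indicator (tube L r) y \<partial>lborel)
           \<le> ball_mass TYPE('a) * ennreal (r ^ (DIM('a) - 1))" (is "?I \<le> _")
proof (rule LIMSEQ_le_const)
  have "(\<lambda>k. (r + 1 / real (Suc k)) ^ (DIM('a) - 1)) \<longlonglongrightarrow> (r + 0) ^ (DIM('a) - 1)"
    by (intro tendsto_intros LIMSEQ_Suc[OF lim_1_over_n])
  then have "(\<lambda>k. ennreal ((r + 1 / real (Suc k)) ^ (DIM('a) - 1))) \<longlonglongrightarrow> ennreal (r ^ (DIM('a) - 1))"
    by (intro tendsto_ennrealI) simp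
  then show "(\<lambda>k. ball_mass TYPE('a) * ennreal ((r + 1 / real (Suc k)) ^ (DIM('a) - 1)))
      \<longlonglongrightarrow> ball_mass TYPE('a) * ennreal (r ^ (DIM('a) - 1))"
    by (intro ennreal_tendsto_cmult ball_mass_finite)
  obtain a u where u: "norm u = 1" and L_eq: "L = range (\<lambda>t. a + t *\<^sub>R u)"
    using L by (rule straight_line_unit_speed)
  have "?I \<le> ball_mass TYPE('a) * ennreal ((r + 1 / real (Suc k)) ^ (DIM('a) - 1))" for k
  proof -
    define s where "s = r + 1 / real (Suc k)"
    have s: "r < s"
      by (simp add: s_def)
    have "tube L r \<subseteq> {y. norm (perp u (y - a)) < s}"
      using tube_perp_le[OF u] s unfolding L_eq by fastforce
    then have "?I \<le> (\<integral>\<^sup>+y. ball_density R (y - c) * indicator {y. norm (perp u (y - a)) < s} y \<partial>lborel)"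
      by (intro nn_integral_mono mult_left_mono) (auto simp: indicator_def)
    also have "\<dots> \<le> ball_mass TYPE('a) * ennreal (s ^ (DIM('a) - 1))"
      using r s by (intro ball_density_mass_tube_le u R) simp
    finally show ?thesis
      by (simp only: s_def)
  qed
  then show "\<exists>N. \<forall>k\<ge>N. ?I \<le> ball_mass TYPE('a) * ennreal ((r + 1 / real (Suc k)) ^ (DIM('a) - 1))"
    by blast
qed

lemma tube_cost_eq:
  assumes "r \<ge> 0"
  shows "tube_cost TYPE('a::euclidean_space) r =
           ennreal (unit_ball_vol (real (DIM('a) - 1))) * ennreal (r ^ (DIM('a) - 1))"
  using assms by (simp add: tube_cost_def ennreal_mult)

text \<open>In any cover of the ball, the masses of the tubes add up to at least the mass of the ball; both
  sides are, up to the common factor \<open>ball_mass\<close>, powers of the radii.\<close>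

lemma tube_cost_le_tube_measure_cball:
  fixes x :: "'a::euclidean_space"
  assumes R: "R > 0"
  shows "tube_cost TYPE('a) R \<le> tube_measure (cball x R)"
proof (rule tube_measure_greatest)
  fix I :: "nat set" and L :: "nat \<Rightarrow> 'a set" and r
  assume cover: "tube_cover (cball x R) I L r"
  let ?m = "ball_mass TYPE('a)" and ?c = "ennreal (unit_ball_vol (real (DIM('a) - 1)))"
  define p where "p i = (if i \<in> I then ennreal (r i ^ (DIM('a) - 1)) else 0)" for i
  define h where "h i y = (if i \<in> I then ball_density R (y - x) * indicator (tube (L i) (r i)) y else 0)"
    for i y
  have [measurable]: "h i \<in> borel_measurable borel" for i
    unfolding h_def by (cases "i \<in> I") simp_all
  have "?m * ennreal (R ^ (DIM('a) - 1)) = (\<integral>\<^sup>+y. ball_density R (y - x) \<partial>lborel)"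
    using nn_integral_ball_density[OF R, of x] by simp
  also have "\<dots> \<le> (\<integral>\<^sup>+y. (\<Sum>i. h i y) \<partial>lborel)"
  proof (rule nn_integral_mono)
    fix y
    show "ball_density R (y - x) \<le> (\<Sum>i. h i y)"
    proof (cases "norm (y - x) < R")
      case True
      then have "y \<in> cball x R"
        by (simp add: dist_norm norm_minus_commute)
      then obtain i where "i \<in> I" "y \<in> tube (L i) (r i)"
        using cover unfolding tube_cover_def by blast
      then have "ball_density R (y - x) = (\<Sum>j\<in>{i}. h j y)"
        by (simp add: h_def)
      also have "\<dots> \<le> (\<Sum>j. h j y)"
        by (rule sum_le_suminf) auto
      finally show ?thesis .
    qed (simp add: ball_density_def)
  qed
  also have "\<dots> = (\<Sum>i. \<integral>\<^sup>+y. h i y \<partial>lborel)"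
    by (rule nn_integral_suminf) simp
  also have "\<dots> \<le> (\<Sum>i. ?m * p i)"
  proof (intro suminf_le)
    fix i
    show "(\<integral>\<^sup>+y. h i y \<partial>lborel) \<le> ?m * p i"
    proof (cases "i \<in> I")
      case True
      then have "straight_line (L i)" "r i > 0"
        using cover by (auto simp: tube_cover_def)
      from ball_density_mass_closed_tube_le[OF this(1) R this(2), of x] True
      show ?thesis
        by (simp add: h_def p_def)
    qed (simp add: h_def)
  qed auto
  also have "\<dots> = ?m * (\<Sum>i. p i)"
    by (rule ennreal_suminf_cmult)
  finally have "ennreal (R ^ (DIM('a) - 1)) \<le> (\<Sum>i. p i)"
    using ball_mass_pos[where 'a = 'a] ball_mass_finite[where 'a = 'a]
    by (simp add: ennreal_mult_le_mult_iff)
  then have "?c * ennreal (R ^ (DIM('a) - 1)) \<le> (\<Sum>i. ?c * p i)"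
    by (simp add: ennreal_suminf_cmult mult_left_mono)
  also have "(\<Sum>i. ?c * p i) = (\<Sum>i. if i \<in> I then tube_cost TYPE('a) (r i) else 0)"
    using cover by (intro suminf_cong) (auto simp: p_def tube_cost_eq tube_cover_def)
  finally show "tube_cost TYPE('a) R \<le> (\<Sum>i. if i \<in> I then tube_cost TYPE('a) (r i) else 0)"
    using R by (simp add: tube_cost_eq)
qed

lemma straight_line_through:
  fixes x y :: "'a::euclidean_space"
  obtains L where "straight_line L" "x \<in> L" "y \<in> L"
proof (cases "x = y")
  case True
  obtain b :: 'a where "b \<in> Basis"
    using nonempty_Basis by blast
  then have "straight_line (range (\<lambda>t. x + t *\<^sub>R b))"
    by (intro straight_line_range) auto
  moreover have "x \<in> range (\<lambda>t. x + t *\<^sub>R b)"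
    by (rule range_eqI[of _ _ 0]) simp
  ultimately show ?thesis
    using True that by blast
next
  case False
  have "straight_line (range (\<lambda>t. x + t *\<^sub>R (y - x)))"
    using False by (intro straight_line_range) auto
  moreover have "x \<in> range (\<lambda>t. x + t *\<^sub>R (y - x))"
    by (rule range_eqI[of _ _ 0]) simp
  moreover have "y \<in> range (\<lambda>t. x + t *\<^sub>R (y - x))"
    by (rule range_eqI[of _ _ 1]) simp
  ultimately show ?thesis
    using that by blast
qed

lemma tube_measure_tube:
  fixes L :: "'a::euclidean_space set"
  assumes "straight_line L" "r > 0"
  shows "tube_measure (tube L r) = tube_cost TYPE('a) r"
proof (rule antisym)
  obtain a u where "L = range (\<lambda>t. a + t *\<^sub>R u)"
    using assms(1) by (rule straight_line_unit_speed)
  then have "cball a r \<subseteq> tube L r"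
    by (intro cball_subset_tube range_eqI[of _ _ 0]) auto
  then show "tube_cost TYPE('a) r \<le> tube_measure (tube L r)"
    using tube_cost_le_tube_measure_cball[OF assms(2), of a] tube_measure_mono order_trans by blast
qed (intro tube_measure_tube_le assms)

lemma tube_measure_cball:
  fixes x :: "'a::euclidean_space"
  assumes "r > 0"
  shows "tube_measure (cball x r) = tube_cost TYPE('a) r"
proof (rule antisym)
  obtain L where "straight_line L" "x \<in> L"
    using straight_line_through[of x x] by blast
  then show "tube_measure (cball x r) \<le> tube_cost TYPE('a) r"
    using tube_measure_mono[OF cball_subset_tube[of x L r]] tube_measure_tube_le[of L r] assms
    by (meson order_trans)
qed (rule tube_cost_le_tube_measure_cball[OF assms])

section \<open>Traces of a measurable set on tubes\<close>

lemma tube_cost_finite [simp]: "tube_cost TYPE('a::euclidean_space) r < top"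
  by (simp add: tube_cost_def)

lemma tube_cost_pos:
  assumes "r > 0"
  shows "0 < tube_cost TYPE('a::euclidean_space) r"
  using assms by (simp add: tube_cost_def)

lemma tube_measure_split:
  assumes "tube_measurable E"
  shows "tube_measure A = tube_measure (A \<inter> E) + tube_measure (A - E)"
  using assms tube_measurable_iff by blast

text \<open>The ball and the tube around it have the same finite measure, and \<open>E\<close> splits both additively.
  Since neither part can decrease when passing from the ball to the tube, both stay the same.\<close>

lemma tube_trace_eq_ball_trace:
  fixes E :: "'a::euclidean_space set"
  assumes E: "tube_measurable E" and L: "straight_line L" "x \<in> L" and r: "r > 0"
  shows "tube_measure (tube L r \<inter> E) = tube_measure (cball x r \<inter> E)"
proof -
  have sub: "cball x r \<subseteq> tube L r"
    using L(2) by (rule cball_subset_tube)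
  have le: "tube_measure (cball x r \<inter> E) \<le> tube_measure (tube L r \<inter> E)"
    "tube_measure (cball x r - E) \<le> tube_measure (tube L r - E)"
    using sub by (intro tube_measure_mono; blast)+
  have eq: "tube_measure (cball x r \<inter> E) + tube_measure (cball x r - E) =
            tube_measure (tube L r \<inter> E) + tube_measure (tube L r - E)"
    using tube_measure_split[OF E, of "cball x r"] tube_measure_split[OF E, of "tube L r"]
      tube_measure_cball[OF r, of x] tube_measure_tube[OF L(1) r] by simp
  have "tube_measure (cball x r - E) \<le> tube_measure (cball x r)"
    by (intro tube_measure_mono) blast
  then have fin: "tube_measure (cball x r - E) < top"
    using tube_measure_cball[OF r, of x] tube_cost_finite order_le_less_trans by metis
  have "tube_measure (tube L r \<inter> E) + tube_measure (cball x r - E) \<le>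
        tube_measure (cball x r \<inter> E) + tube_measure (cball x r - E)"
    unfolding eq by (intro add_left_mono le)
  then have "tube_measure (tube L r \<inter> E) \<le> tube_measure (cball x r \<inter> E)"
    using fin by (auto simp: add.commute[of _ "tube_measure (cball x r - E)"] ennreal_add_left_cancel_le)
  with le(1) show ?thesis
    by simp
qed

text \<open>Balls with centres on a common line are inscribed in the same tube, and any two points lie on a
  line. So the trace of \<open>E\<close> on a ball or tube depends on the radius only.\<close>

lemma tube_trace_eq:
  fixes E :: "'a::euclidean_space set"
  assumes E: "tube_measurable E" and L: "straight_line L" and r: "r > 0"
  shows "tube_measure (tube L r \<inter> E) = tube_measure (cball 0 r \<inter> E)"
proof -
  have "L \<noteq> {}"
    using L by (auto simp: straight_line_def)
  then obtain x where x: "x \<in> L"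
    by blast
  obtain M where M: "straight_line M" "x \<in> M" "0 \<in> M"
    using straight_line_through[of x 0] by blast
  show ?thesis
    using tube_trace_eq_ball_trace[OF E L x r] tube_trace_eq_ball_trace[OF E M(1,2) r]
      tube_trace_eq_ball_trace[OF E M(1,3) r] by simp
qed

text \<open>A bounded part \<open>A\<close> of \<open>E\<close> is covered by the traces of \<open>E\<close> on the tubes of any cover of \<open>A\<close>, and
  these traces are cheaper than the tubes by the factor \<open>q\<close>. Minimizing over all covers,
  \<open>\<mu> A \<le> q * \<mu> A\<close>, and \<open>\<mu> A\<close> is finite.\<close>

lemma tube_null_if_sparse:
  fixes E :: "'a::euclidean_space set"
  assumes E: "tube_measurable E" and q: "0 < q" "q < 1"
    and sparse: "\<And>r. r > 0 \<Longrightarrow> tube_measure (cball 0 r \<inter> E) \<le> ennreal q * tube_cost TYPE('a) r"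
  shows "tube_measure E = 0"
proof -
  have null: "tube_measure (cball 0 R \<inter> E) = 0" if R: "R > 0" for R
  proof -
    let ?A = "cball 0 R \<inter> E"
    have "ennreal (1 / q) * tube_measure ?A \<le> tube_measure ?A"
    proof (rule tube_measure_greatest)
      fix I L r
      assume cover: "tube_cover ?A I L r"
      let ?T = "\<lambda>i. if i \<in> I then tube (L i) (r i) \<inter> E else {}"
      let ?S = "\<Sum>i. if i \<in> I then tube_cost TYPE('a) (r i) else 0"
      have "tube_measure ?A \<le> tube_measure (\<Union>i. ?T i)"
        using cover unfolding tube_cover_def by (intro tube_measure_mono) fastforce
      also have "\<dots> \<le> (\<Sum>i. tube_measure (?T i))"
        by (rule tube_measure_countably_subadditive)
      also have "\<dots> \<le> (\<Sum>i. ennreal q * (if i \<in> I then tube_cost TYPE('a) (r i) else 0))"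
      proof (intro suminf_le)
        fix i
        show "tube_measure (?T i) \<le> ennreal q * (if i \<in> I then tube_cost TYPE('a) (r i) else 0)"
          using cover sparse[of "r i"] tube_trace_eq[OF E, of "L i" "r i"]
          by (auto simp: tube_cover_def)
      qed auto
      also have "\<dots> = ennreal q * ?S"
        by (rule ennreal_suminf_cmult)
      finally have "ennreal (1 / q) * tube_measure ?A \<le> ennreal (1 / q) * (ennreal q * ?S)"
        by (rule mult_left_mono) simp
      also have "\<dots> = ?S"
        using q by (simp add: mult.assoc[symmetric] ennreal_mult'[symmetric])
      finally show "ennreal (1 / q) * tube_measure ?A \<le> ?S" .
    qed
    moreover have "tube_measure ?A < top"
      using sparse[OF R] tube_cost_finite[where 'a = 'a, of R]
      by (meson ennreal_less_top ennreal_mult_less_top order_le_less_trans)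
    ultimately show ?thesis
      using q by (cases "tube_measure ?A") (auto simp: ennreal_mult'[symmetric] field_simps mult_le_cancel_left1)
  qed
  have "E \<subseteq> (\<Union>k::nat. cball 0 (real (Suc k)) \<inter> E)"
  proof
    fix x assume "x \<in> E"
    moreover obtain k :: nat where "norm x \<le> real k"
      using real_arch_simple by blast
    ultimately show "x \<in> (\<Union>k::nat. cball 0 (real (Suc k)) \<inter> E)"
      by (intro UN_I[of k]) auto
  qed
  then have "tube_measure E \<le> tube_measure (\<Union>k::nat. cball 0 (real (Suc k)) \<inter> E)"
    by (rule tube_measure_mono)
  also have "\<dots> \<le> (\<Sum>k. tube_measure (cball 0 (real (Suc k)) \<inter> E))"
    by (rule tube_measure_countably_subadditive)
  also have "\<dots> = 0"
    using null by (simp del: of_nat_Suc)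
  finally show ?thesis
    by simp
qed

section \<open>Comparison of different radii\<close>

text \<open>The axes pass through a grid of mesh \<open>2 * r / n\<close> in a coordinate hyperplane: rounding each of
  the \<open>n - 1\<close> coordinates moves a point by at most \<open>r / n\<close> per coordinate, so by less than \<open>r\<close> in total.
  What matters is that the number of tubes has the order \<open>(R / r) ^ (n - 1)\<close>, with a factor
  depending on \<open>n\<close> alone.\<close>

lemma cball_covered_by_parallel_tubes:
  fixes r R :: real
  assumes r: "0 < r" "r \<le> R"
  obtains F :: "'a::euclidean_space set set" where "finite F"
    "real (card F) \<le> (real DIM('a) + 3) ^ (DIM('a) - 1) * (R / r) ^ (DIM('a) - 1)"
    "\<And>L. L \<in> F \<Longrightarrow> straight_line L" "cball 0 R \<subseteq> (\<Union>L\<in>F. tube L r)"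
proof -
  obtain b :: 'a where b: "b \<in> Basis"
    using nonempty_Basis by blast
  define n where "n = real DIM('a)"
  define s where "s = 2 * r / n"
  define M where "M = \<lceil>R / s\<rceil>"
  define \<Phi> where "\<Phi> = (Basis - {b}) \<rightarrow>\<^sub>E {-M..M}"
  define line where "line \<phi> = range (\<lambda>t. (\<Sum>i\<in>Basis - {b}. (s * of_int (\<phi> i)) *\<^sub>R i) + t *\<^sub>R b)"
    for \<phi> :: "'a \<Rightarrow> int"
  have n: "1 \<le> n"
    using DIM_positive[where 'a = 'a] by (simp add: n_def Suc_le_eq del: DIM_positive)
  have s: "0 < s"
    using r n by (simp add: s_def)
  have "0 \<le> R / s"
    using r s by simp
  then have M: "0 \<le> M" "R / s \<le> of_int M" "of_int M \<le> R / s + 1"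
    unfolding M_def by linarith+
  have fin: "finite \<Phi>"
    unfolding \<Phi>_def by (intro finite_PiE) auto
  show ?thesis
  proof (rule that[of "line ` \<Phi>"])
    show "finite (line ` \<Phi>)"
      using fin by simp
    show "straight_line L" if "L \<in> line ` \<Phi>" for L
      using that b unfolding line_def by (auto intro!: straight_line_range)
    have "real (card (line ` \<Phi>)) \<le> real (card \<Phi>)"
      using card_image_le[OF fin] by simp
    also have "card \<Phi> = nat (2 * M + 1) ^ (DIM('a) - 1)"
      unfolding \<Phi>_def using b M by (simp add: card_PiE card_Diff_singleton)
    also have "real \<dots> = (2 * of_int M + 1) ^ (DIM('a) - 1)"
      using M by simp
    also have "\<dots> \<le> ((n + 3) * (R / r)) ^ (DIM('a) - 1)"
    proof (rule power_mono)
      have "2 * of_int M + 1 \<le> 2 * (R / s) + 3"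
        using M by simp
      also have "2 * (R / s) = n * (R / r)"
        using r n by (simp add: s_def)
      finally have "2 * of_int M + 1 \<le> n * (R / r) + 3" .
      moreover have "1 \<le> R / r"
        using r by simp
      ultimately show "2 * of_int M + 1 \<le> (n + 3) * (R / r)"
        unfolding distrib_right by linarith
    qed (use M in simp)
    finally show "real (card (line ` \<Phi>)) \<le> (real DIM('a) + 3) ^ (DIM('a) - 1) * (R / r) ^ (DIM('a) - 1)"
      by (simp only: n_def power_mult_distrib)
    show "cball 0 R \<subseteq> (\<Union>L\<in>line ` \<Phi>. tube L r)"
    proof
      fix x :: 'a assume "x \<in> cball 0 R"
      then have x: "norm x \<le> R"
        by simp
      define \<phi> where "\<phi> = (\<lambda>i\<in>Basis - {b}. round (x \<bullet> i / s))"
      have "\<phi> \<in> \<Phi>"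
        unfolding \<Phi>_def \<phi>_def
      proof (rule restrict_PiE_iff[THEN iffD2], intro ballI)
        fix i assume "i \<in> Basis - {b}"
        then have "\<bar>x \<bullet> i\<bar> \<le> R"
          using Basis_le_norm[of i x] x by auto
        then have "\<bar>x \<bullet> i / s\<bar> \<le> R / s"
          using s by (simp add: abs_divide divide_right_mono)
        then have "of_int (- M) \<le> x \<bullet> i / s" "x \<bullet> i / s \<le> of_int M"
          using M(2) by linarith+
        from round_mono[OF this(1)] round_mono[OF this(2)]
        show "round (x \<bullet> i / s) \<in> {-M..M}"
          by (simp only: round_of_int atLeastAtMost_iff)
      qed
      moreover have "x \<in> tube (line \<phi>) r"
      proof -
        define z where "z = (\<Sum>i\<in>Basis - {b}. (s * of_int (\<phi> i)) *\<^sub>R i) + (x \<bullet> b) *\<^sub>R b"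
        have "x = (\<Sum>i\<in>Basis. (x \<bullet> i) *\<^sub>R i)"
          by (simp add: euclidean_representation)
        also have "\<dots> = (x \<bullet> b) *\<^sub>R b + (\<Sum>i\<in>Basis - {b}. (x \<bullet> i) *\<^sub>R i)"
          using b by (subst sum.remove[of _ b]) auto
        finally have "x - z = (\<Sum>i\<in>Basis - {b}. (x \<bullet> i) *\<^sub>R i) - (\<Sum>i\<in>Basis - {b}. (s * of_int (\<phi> i)) *\<^sub>R i)"
          unfolding z_def by (metis (no_types, lifting) add.commute add_diff_cancel_left)
        also have "\<dots> = (\<Sum>i\<in>Basis - {b}. (x \<bullet> i - s * of_int (\<phi> i)) *\<^sub>R i)"
          by (simp add: scaleR_diff_left sum_subtractf)
        finally have "norm (x - z) \<le> (\<Sum>i\<in>Basis - {b}. norm ((x \<bullet> i - s * of_int (\<phi> i)) *\<^sub>R i))"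
          by (simp only: norm_sum)
        also have "\<dots> \<le> (\<Sum>i\<in>Basis - {b}. s / 2)"
        proof (rule sum_mono)
          fix i assume i: "i \<in> Basis - {b}"
          have "\<bar>of_int (round (x \<bullet> i / s)) - x \<bullet> i / s\<bar> \<le> 1 / 2"
            by (rule of_int_round_abs_le)
          then have "s * \<bar>of_int (round (x \<bullet> i / s)) - x \<bullet> i / s\<bar> \<le> s * (1 / 2)"
            using s by (intro mult_left_mono) auto
          also have "s * \<bar>of_int (round (x \<bullet> i / s)) - x \<bullet> i / s\<bar> =
                     \<bar>s * (of_int (round (x \<bullet> i / s)) - x \<bullet> i / s)\<bar>"
            using s by (simp add: abs_mult)
          also have "s * (of_int (round (x \<bullet> i / s)) - x \<bullet> i / s) = s * of_int (\<phi> i) - x \<bullet> i"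
            using s i by (simp add: \<phi>_def right_diff_distrib)
          finally show "norm ((x \<bullet> i - s * of_int (\<phi> i)) *\<^sub>R i) \<le> s / 2"
            using i by (simp add: abs_minus_commute)
        qed
        also have "\<dots> = (n - 1) * (s / 2)"
          using b by (simp add: n_def card_Diff_singleton of_nat_diff Suc_le_eq)
        also have "\<dots> \<le> n * (s / 2)"
          using s by simp
        also have "\<dots> = r"
          using n by (simp add: s_def)
        finally have "dist x z \<le> r"
          by (simp add: dist_norm)
        moreover have "z \<in> line \<phi>"
          unfolding line_def z_def by blast
        ultimately show ?thesis
          unfolding tube_def using infdist_le[of z "line \<phi>" x] by simp
      qed
      ultimately show "x \<in> (\<Union>L\<in>line ` \<Phi>. tube L r)"
        by blast
    qed
  qed
qed

text \<open>All tubes of radius \<open>r\<close> in an economical cover of the larger ball meet \<open>E\<close> in the same small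
  measure, and they cost together at most the stated power of \<open>n + 3\<close> times one tube of radius \<open>R\<close>.
  So sparseness at one radius passes on to all larger radii, with a loss depending only on \<open>n\<close>.\<close>

lemma tube_trace_growth:
  fixes E :: "'a::euclidean_space set"
  assumes E: "tube_measurable E" and r: "0 < r" "r \<le> R" and e: "0 \<le> e"
    and sparse: "tube_measure (cball 0 r \<inter> E) \<le> ennreal e * tube_cost TYPE('a) r"
  shows "tube_measure (cball 0 R \<inter> E) \<le>
           ennreal ((real DIM('a) + 3) ^ (DIM('a) - 1) * e) * tube_cost TYPE('a) R"
proof -
  obtain F :: "'a set set" where F: "finite F"
    "real (card F) \<le> (real DIM('a) + 3) ^ (DIM('a) - 1) * (R / r) ^ (DIM('a) - 1)"
    "\<And>L. L \<in> F \<Longrightarrow> straight_line L" "cball 0 R \<subseteq> (\<Union>L\<in>F. tube L r)"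
    using cball_covered_by_parallel_tubes[OF r] by blast
  let ?K = "(real DIM('a) + 3) ^ (DIM('a) - 1)" and ?v = "unit_ball_vol (real (DIM('a) - 1))"
  have "tube_measure (cball 0 R \<inter> E) \<le> tube_measure (\<Union>L\<in>F. tube L r \<inter> E)"
    using F(4) by (intro tube_measure_mono) blast
  also have "\<dots> \<le> (\<Sum>L\<in>F. tube_measure (tube L r \<inter> E))"
    by (rule tube_measure_finitely_subadditive[OF F(1)])
  also have "\<dots> = of_nat (card F) * tube_measure (cball 0 r \<inter> E)"
    using tube_trace_eq[OF E F(3) r(1)] by simp
  also have "\<dots> \<le> ennreal (?K * (R / r) ^ (DIM('a) - 1)) * (ennreal e * tube_cost TYPE('a) r)"
    using F(2) sparse by (intro mult_mono) (auto simp: ennreal_of_nat_eq_real_of_nat intro: ennreal_leI)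
  also have "\<dots> = ennreal (?K * (R / r) ^ (DIM('a) - 1) * (e * (?v * r ^ (DIM('a) - 1))))"
    using e r by (simp add: tube_cost_def ennreal_mult')
  also have "?K * (R / r) ^ (DIM('a) - 1) * (e * (?v * r ^ (DIM('a) - 1))) =
             ?K * e * (?v * R ^ (DIM('a) - 1))"
    using r by (simp add: power_divide)
  also have "ennreal \<dots> = ennreal (?K * e) * tube_cost TYPE('a) R"
    using e by (simp add: tube_cost_def ennreal_mult')
  finally show ?thesis .
qed

lemma tube_sparse_complement:
  fixes E :: "'a::euclidean_space set"
  assumes E: "tube_measurable E" and r: "0 < r" and e: "0 < e" "e < 1"
    and dense: "\<not> tube_measure (cball 0 r \<inter> E) \<le> ennreal (1 - e) * tube_cost TYPE('a) r"
  shows "tube_measure (cball 0 r - E) \<le> ennreal e * tube_cost TYPE('a) r"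
proof -
  obtain c where c: "0 < c" "tube_cost TYPE('a) r = ennreal c"
    using tube_cost_pos[OF r] tube_cost_finite by (metis ennreal_cases ennreal_less_zero_iff less_irrefl)
  have sum: "tube_measure (cball 0 r \<inter> E) + tube_measure (cball 0 r - E) = ennreal c"
    using tube_measure_split[OF E, of "cball 0 r"] tube_measure_cball[OF r, of "0::'a"] c by simp
  then obtain x y where xy: "0 \<le> x" "0 \<le> y" "tube_measure (cball 0 r \<inter> E) = ennreal x"
      "tube_measure (cball 0 r - E) = ennreal y"
    by (metis add_eq_0_iff_both_eq_0 ennreal_add_eq_top ennreal_cases ennreal_neq_top)
  then have "x + y = c" "(1 - e) * c < x"
    using sum dense c e by (auto simp: ennreal_plus[symmetric] ennreal_mult'[symmetric] not_le
        ennreal_less_iff simp del: ennreal_plus)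
  then have "y \<le> e * c"
    by (simp add: left_diff_distrib)
  then show ?thesis
    using xy c e by (simp add: ennreal_mult'[symmetric] ennreal_leI)
qed

text \<open>If neither \<open>E\<close> nor its complement is null, then \<open>E\<close> nearly fills a ball of some radius \<open>r\<close> and its
  complement nearly fills a ball of some radius \<open>r'\<close>. At the larger of these radii both would be sparse.\<close>

lemma tube_measurable_imp_null:
  fixes E :: "'a::euclidean_space set"
  assumes E: "tube_measurable E"
  shows "tube_measure E = 0 \<or> tube_measure (UNIV - E) = 0"
proof (rule ccontr)
  assume "\<not> ?thesis"
  then have pos: "tube_measure E \<noteq> 0" "tube_measure (UNIV - E) \<noteq> 0"
    by auto
  have E': "tube_measurable (UNIV - E)"
    using E by (simp only: tube_measurable_Compl)
  define K where "K = (real DIM('a) + 3) ^ (DIM('a) - 1)"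
  (* tube_trace_growth loses a factor K; any bound below 1/2 for each of the two parts suffices. *)
  define e where "e = 1 / (3 * K)"
  have K: "1 \<le> K"
    unfolding K_def by (rule one_le_power) simp
  then have e: "0 < e" "e < 1" "K * e = 1 / 3"
    by (auto simp: e_def field_simps)
  obtain r where r: "0 < r" "\<not> tube_measure (cball 0 r \<inter> E) \<le> ennreal (1 - e) * tube_cost TYPE('a) r"
    using tube_null_if_sparse[OF E, of "1 - e"] e pos(1) by auto
  obtain r' where r': "0 < r'"
      "\<not> tube_measure (cball 0 r' \<inter> (UNIV - E)) \<le> ennreal (1 - e) * tube_cost TYPE('a) r'"
    using tube_null_if_sparse[OF E', of "1 - e"] e pos(2) by auto
  define R where "R = max r r'"
  have R: "0 < R" "r \<le> R" "r' \<le> R"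
    using r by (auto simp: R_def)
  have "tube_measure (cball 0 r \<inter> (UNIV - E)) \<le> ennreal e * tube_cost TYPE('a) r"
    using tube_sparse_complement[OF E r(1) e(1,2) r(2)] by (simp add: Diff_eq)
  from tube_trace_growth[OF E' r(1) R(2) less_imp_le[OF e(1)] this]
  have 1: "tube_measure (cball 0 R - E) \<le> ennreal (1 / 3) * tube_cost TYPE('a) R"
    by (simp only: e(3)[unfolded K_def] Diff_eq Int_UNIV_left)
  have "tube_measure (cball 0 r' \<inter> E) \<le> ennreal e * tube_cost TYPE('a) r'"
    using tube_sparse_complement[OF E' r'(1) e(1,2) r'(2)] by (simp add: Diff_eq)
  from tube_trace_growth[OF E r'(1) R(3) less_imp_le[OF e(1)] this]
  have 2: "tube_measure (cball 0 R \<inter> E) \<le> ennreal (1 / 3) * tube_cost TYPE('a) R"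
    by (simp only: e(3)[unfolded K_def])
  obtain c where c: "0 < c" "tube_cost TYPE('a) R = ennreal c"
    using tube_cost_pos[OF R(1)] tube_cost_finite by (metis ennreal_cases ennreal_less_zero_iff less_irrefl)
  have "ennreal c = tube_measure (cball 0 R \<inter> E) + tube_measure (cball 0 R - E)"
    using tube_measure_split[OF E, of "cball 0 R"] tube_measure_cball[OF R(1), of "0::'a"] c by simp
  also have "\<dots> \<le> ennreal (1 / 3) * ennreal c + ennreal (1 / 3) * ennreal c"
    using add_mono[OF 2 1] c by simp
  also have "\<dots> = ennreal (1 / 3 * c + 1 / 3 * c)"
    using c by (simp add: ennreal_mult'[symmetric] ennreal_plus[symmetric] del: ennreal_plus)
  also have "\<dots> < ennreal c"
    using c by (intro ennreal_lessI) auto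
  finally show False
    by simp
qed

theorem theorem1:
  fixes E :: "(real ^ 'n) set"
  shows "tube_measurable E \<longleftrightarrow> tube_measure E = 0 \<or> tube_measure (UNIV - E) = 0"
  using tube_measurable_imp_null tube_measurable_if_null by blast

end
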